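(* Let $p(x,y), g(x,y) \in \mathbb{R}[x,y]$ be two polynomials that have the same zero set in $\mathbb{R}^2$, and let $n = \deg_x p$. If there are infinitely many horizontal lines in $\mathbb{R}^2$ each of which intersects this zero set in at least $n$ distinct points, then $p$ and $g$ have a common factor in $\mathbb{R}[x,y]$ with the same zero set as $p$ and $g$.
   Context: The zero set of $f\in\mathbb{R}[x,y]$ is $\{(a,b)\in\mathbb{R}^2 : f(a,b)=0\}$. $\deg_x p$ denotes the degree of $p$ in the variable $x$, i.e. the degree of $p$ viewed as a polynomial in $x$ with coefficients in $\mathbb{R}[y]$. A horizontal line is a line $\{(x,y_0): x\in\mathbb{R}\}$ for some $y_0\in\mathbb{R}$. A common factor of $p$ and $g$ is a polynomial in $\mathbb{R}[x,y]$ dividing both $p$ and $g$ in $\mathbb{R}[x,y]$. *)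

theory Defs
  imports Complex_Main "HOL-Computational_Algebra.Computational_Algebra"
begin

text \<open>
  The ring R[x,y] is represented as R[y][x], i.e. by the type real poly poly whose outer
  variable is x and whose inner variable is y.
\<close>

type_synonym bpoly = "real poly poly"

definition eval_xy :: "bpoly \<Rightarrow> real \<Rightarrow> real \<Rightarrow> real" where
  "eval_xy f a b = poly (poly f [:a:]) b"

definition zero_set :: "bpoly \<Rightarrow> (real \<times> real) set" where
  "zero_set f = {(a, b). eval_xy f a b = 0}"

text \<open>By the convention for degree, the zero polynomial has degree 0.\<close>

abbreviation deg_x :: "bpoly \<Rightarrow> nat" where
  "deg_x f \<equiv> degree f"

definition horizontal_line :: "(real \<times> real) set \<Rightarrow> bool" where
  "horizontal_line L \<longleftrightarrow> (\<exists>y0. L = {(x, y0) | x. True})"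

text \<open>An infinite S has at least n elements for every n, whereas its card is 0.\<close>

definition at_least_points :: "nat \<Rightarrow> 'a set \<Rightarrow> bool" where
  "at_least_points n S \<longleftrightarrow> (\<exists>A \<subseteq> S. finite A \<and> card A = n)"

lemma eval_xy_variables:
  "eval_xy [:0, 1:] a b = a" "eval_xy [:[:0, 1:]:] a b = b"
  by (simp_all add: eval_xy_def)

end

theory Submission
  imports Defs "HOL-Computational_Algebra.Field_as_Ring"
begin

text \<open>
  The common factor is \<open>h = gcd p g\<close>. Write \<open>p = h p'\<close> and \<open>g = h g'\<close> with \<open>p'\<close> and \<open>g'\<close>
  coprime. If \<open>p'\<close> has positive degree in \<open>x\<close>, then on all but finitely many of the given lines
  \<open>p\<close> has \<open>n\<close> distinct zeros, of which at most \<open>deg_x h < n\<close> are zeros of \<open>h\<close>. A remaining one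
  is a common zero of \<open>p'\<close> and \<open>g'\<close>. This happens on infinitely many lines, whereas some nonzero
  polynomial in \<open>y\<close> alone lies in the ideal generated by \<open>p'\<close> and \<open>g'\<close>. So \<open>p'\<close> depends on \<open>y\<close>
  only. If it vanishes on a line \<open>y = b\<close>, then so does \<open>g\<close>; the prime \<open>y - b\<close> divides \<open>p'\<close>,
  hence not \<open>g'\<close>, hence it divides \<open>h\<close>.
\<close>

text \<open>By Gauss's lemma, passing to primitive parts turns the constant factor \<open>a\<close>
  into a unit. This cancels the multiplier that pseudo-division introduces.\<close>

lemma primitive_part_dvd_if_dvd_smult:
  fixes f p :: "'a :: {factorial_ring_gcd, semiring_gcd_mult_normalize} poly"
  assumes "f dvd smult a p" and "a \<noteq> 0"
  shows "primitive_part f dvd p"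
proof -
  have "primitive_part f dvd primitive_part (smult a p)"
    using assms(1) by (rule primitive_part_dvd_primitive_partI)
  hence "primitive_part f dvd smult (unit_factor a) (primitive_part p)"
    by (simp add: primitive_part_smult)
  moreover have "is_unit [:unit_factor a:]"
    using assms(2) by (simp add: is_unit_const_poly_iff)
  ultimately have "primitive_part f dvd primitive_part p"
    using dvd_mult_unit_iff'[of "[:unit_factor a:]" "primitive_part f" "primitive_part p"] by simp
  thus ?thesis
    by (metis content_times_primitive_part dvd_smult)
qed

text \<open>Bezout's identity over the fraction field with denominators cleared. An element of least
  degree in the ideal generated by \<open>p\<close> and \<open>q\<close> has a primitive part
  dividing both, hence a unit, so the element is constant. Over R[y], \<open>c\<close> is a
  polynomial in \<open>y\<close> alone.\<close>

lemma coprime_poly_combination_const: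
  fixes p q :: "'a :: {factorial_ring_gcd, semiring_gcd_mult_normalize} poly"
  assumes "coprime p q"
  shows "\<exists>s t c. c \<noteq> 0 \<and> s * p + t * q = [:c:]"
proof -
  define I where "I = {f. f \<noteq> 0 \<and> (\<exists>s t. s * p + t * q = f)}"
  have "p \<in> I \<or> q \<in> I"
  proof -
    have "1 * p + 0 * q = p" "0 * p + 1 * q = q"
      by simp_all
    moreover have "p \<noteq> 0 \<or> q \<noteq> 0"
      using assms by auto
    ultimately show ?thesis
      unfolding I_def by blast
  qed
  then obtain f where f: "f \<in> I" and min: "\<And>f'. f' \<in> I \<Longrightarrow> degree f \<le> degree f'"
    using ex_has_least_nat[of "\<lambda>f. f \<in> I" _ degree] by metis
  obtain s t where st: "s * p + t * q = f" and f0: "f \<noteq> 0"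
    using f by (auto simp: I_def)
  have dvd: "primitive_part f dvd s' * p + t' * q" for s' t'
  proof -
    let ?u = "s' * p + t' * q"
    \<comment> \<open>The pseudo-remainder stays in the ideal and is zero or of smaller degree than
      \<open>f\<close>, so minimality forces it to vanish.\<close>
    define r where "r = pseudo_mod ?u f"
    obtain a w where a: "a \<noteq> 0" and w: "smult a ?u = f * w + r"
      using pseudo_mod(1)[OF f0, of ?u] unfolding r_def by blast
    have "r = (smult a s' - w * s) * p + (smult a t' - w * t) * q"
      using w by (simp add: algebra_simps smult_add_right flip: st)
    hence "r \<in> I" if "r \<noteq> 0"
      using that unfolding I_def by blast
    hence "r = 0"
      using min[of r] pseudo_mod(2)[OF f0, of ?u] unfolding r_def by fastforce
    hence "f dvd smult a ?u"
      using w by simp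
    thus ?thesis
      using a by (rule primitive_part_dvd_if_dvd_smult)
  qed
  have "primitive_part f dvd p" "primitive_part f dvd q"
    using dvd[of 1 0] dvd[of 0 1] by simp_all
  hence "is_unit (primitive_part f)"
    using assms by (metis coprime_def)
  hence "degree f = 0"
    by (metis degree_primitive_part is_unit_poly_iff degree_pCons_0)
  thus ?thesis
    using f0 st by (metis degree_0_id degree_eq_zeroE pCons_0_0)
qed

lemma eval_xy_mult: "eval_xy (f * h) a b = eval_xy f a b * eval_xy h a b"
  by (simp add: eval_xy_def)

lemma eval_xy_add: "eval_xy (f + h) a b = eval_xy f a b + eval_xy h a b"
  by (simp add: eval_xy_def)

lemma eval_xy_const: "eval_xy [:c:] a b = poly c b"
  by (simp add: eval_xy_def)

text \<open>Substituting for \<open>y\<close> first gives a real polynomial in \<open>x\<close>, to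
  which univariate root counting applies.\<close>

lemma eval_xy_eq_poly_map_poly: "eval_xy f a b = poly (map_poly (\<lambda>c. poly c b) f) a"
  by (induction f) (simp_all add: eval_xy_def map_poly_pCons)

text \<open>The leading coefficient survives setting \<open>y = b\<close>, so the restriction to the
  line is a nonzero polynomial in \<open>x\<close>.\<close>

lemma horizontal_zeros_bound:
  assumes "poly (lead_coeff f) b \<noteq> 0"
  shows "finite {a. eval_xy f a b = 0}" and "card {a. eval_xy f a b = 0} \<le> degree f"
proof -
  let ?f = "map_poly (\<lambda>c. poly c b) f"
  have "coeff ?f (degree f) \<noteq> 0"
    using assms by (simp add: coeff_map_poly)
  hence "?f \<noteq> 0"
    by auto
  moreover have "degree ?f \<le> degree f"
    by (intro degree_le) (simp add: coeff_map_poly coeff_eq_0)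
  ultimately show "finite {a. eval_xy f a b = 0}" "card {a. eval_xy f a b = 0} \<le> degree f"
    using poly_roots_finite[of ?f] card_poly_roots_bound[of ?f] \<open>degree ?f \<le> degree f\<close>
    by (auto simp: eval_xy_eq_poly_map_poly)
qed

text \<open>The restriction to the line is the zero polynomial, so the factor theorem in
  \<open>y\<close> applies to each coefficient.\<close>

lemma vanishes_on_line_imp_dvd:
  assumes "\<And>a. eval_xy f a b = 0"
  shows "[:[:-b, 1:]:] dvd f"
proof -
  have "map_poly (\<lambda>c. poly c b) f = 0"
    using assms by (metis eval_xy_eq_poly_map_poly poly_all_0_iff_0)
  hence "poly (coeff f i) b = 0" for i
    by (metis coeff_map_poly coeff_0 poly_0)
  thus ?thesis
    by (simp add: const_poly_dvd_iff poly_eq_0_iff_dvd)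
qed

lemma infinite_heights_if_infinite_lines:
  assumes "infinite {L. horizontal_line L \<and> at_least_points n (L \<inter> zero_set p)}"
  shows "infinite {b. \<exists>A. finite A \<and> card A = n \<and> (\<forall>a\<in>A. eval_xy p a b = 0)}"
    (is "infinite ?Y")
proof
  assume "finite ?Y"
  moreover have "{L. horizontal_line L \<and> at_least_points n (L \<inter> zero_set p)}
      \<subseteq> (\<lambda>b. {(x, b) | x. True}) ` ?Y"
  proof safe
    fix L assume "horizontal_line L" and "at_least_points n (L \<inter> zero_set p)"
    then obtain b A where L: "L = {(x, b) | x. True}"
      and A: "A \<subseteq> L \<inter> zero_set p" "finite A" "card A = n"
      by (auto simp: horizontal_line_def at_least_points_def)
    \<comment> \<open>All points of \<open>A\<close> have height \<open>b\<close>, so their first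
      coordinates are distinct.\<close>
    have "inj_on fst A"
      using A(1) L by (auto simp: inj_on_def)
    hence "card (fst ` A) = n"
      using A(3) by (simp add: card_image)
    moreover have "\<forall>a \<in> fst ` A. eval_xy p a b = 0"
      using A(1) L by (auto simp: zero_set_def)
    ultimately have "b \<in> ?Y"
      using A(2) by blast
    thus "L \<in> (\<lambda>b. {(x, b) | x. True}) ` ?Y"
      using L by blast
  qed
  ultimately show False
    using assms by (meson finite_imageI finite_subset)
qed

lemma degree_cofactor_eq_0:
  fixes h p' g' :: bpoly
  assumes p0: "h * p' \<noteq> 0"
    and cop: "coprime p' g'"
    and zeros: "\<And>a b. eval_xy (h * p') a b = 0 \<Longrightarrow> eval_xy (h * g') a b = 0"
    and inf: "infinite {b. \<exists>A. finite A \<and> card A = degree (h * p')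
                \<and> (\<forall>a\<in>A. eval_xy (h * p') a b = 0)}" (is "infinite ?Y")
  shows "degree p' = 0"
proof (rule ccontr)
  assume deg: "degree p' \<noteq> 0"
  obtain s t c where c: "c \<noteq> 0" and st: "s * p' + t * g' = [:c:]"
    using coprime_poly_combination_const[OF cop] by blast
  have "poly c b = 0" if b: "b \<in> ?Y" and lead: "poly (lead_coeff (h * p')) b \<noteq> 0" for b
  proof -
    obtain A where A: "finite A" "card A = degree (h * p')"
      "\<And>a. a \<in> A \<Longrightarrow> eval_xy (h * p') a b = 0"
      using b by blast
    have lead_h: "poly (lead_coeff h) b \<noteq> 0"
      using lead by (simp add: lead_coeff_mult)
    \<comment> \<open>Strict because degrees add and \<open>p'\<close> has positive degree.\<close>
    have "card {a. eval_xy h a b = 0} < card A"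
      using horizontal_zeros_bound(2)[OF lead_h] deg p0 A(2) by (simp add: degree_mult_eq)
    hence "\<not> A \<subseteq> {a. eval_xy h a b = 0}"
      using card_mono[OF horizontal_zeros_bound(1)[OF lead_h], of A] by linarith
    then obtain a where a: "a \<in> A" "eval_xy h a b \<noteq> 0"
      by blast
    have "eval_xy p' a b = 0" "eval_xy g' a b = 0"
      using A(3)[OF a(1)] zeros[OF A(3)[OF a(1)]] a(2) by (simp_all add: eval_xy_mult)
    hence "eval_xy [:c:] a b = 0"
      by (simp add: eval_xy_add eval_xy_mult flip: st)
    thus ?thesis
      by (simp add: eval_xy_const)
  qed
  hence "?Y \<subseteq> {b. poly c b = 0} \<union> {b. poly (lead_coeff (h * p')) b = 0}"
    by blast
  moreover have "finite ({b. poly c b = 0} \<union> {b. poly (lead_coeff (h * p')) b = 0})"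
    using p0 c by (intro finite_UnI poly_roots_finite) simp_all
  ultimately show False
    using inf finite_subset by blast
qed

theorem theorem5:
  fixes p g :: bpoly and n :: nat
  assumes "zero_set p = zero_set g"
    and "n = deg_x p"
    and "infinite {L. horizontal_line L \<and> at_least_points n (L \<inter> zero_set p)}"
  shows "\<exists>h :: bpoly. h dvd p \<and> h dvd g \<and> zero_set h = zero_set p \<and> zero_set h = zero_set g"
proof (cases "p = 0")
  case True
  \<comment> \<open>Everything divides 0, so \<open>g\<close> itself is a common factor.\<close>
  thus ?thesis
    using assms(1) by (intro exI[of _ g]) simp
next
  case False
  have same_zeros: "eval_xy p a b = 0 \<longleftrightarrow> eval_xy g a b = 0" for a b
    using assms(1) by (auto simp: zero_set_def set_eq_iff)
  define h where "h = gcd p g"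
  \<comment> \<open>Since \<open>p\<close> is nonzero, so is the gcd, and dividing by it leaves
    coprime cofactors.\<close>
  obtain p' g' where p: "p = h * p'" and g: "g = h * g'" and cop: "coprime p' g'"
    using gcd_coprime_exists[of p g] False unfolding h_def by (metis gcd_eq_0_iff mult.commute)
  have "degree p' = 0"
    using degree_cofactor_eq_0[of h p' g'] cop False same_zeros
      infinite_heights_if_infinite_lines[OF assms(3)] assms(2)
    unfolding p g by blast
  then obtain c where c: "p' = [:c:]"
    by (rule degree_eq_zeroE)
  have eval_p: "eval_xy p a b = eval_xy h a b * poly c b" for a b
    by (simp only: p c eval_xy_mult eval_xy_const)
  have "eval_xy h a b = 0" if "eval_xy p a b = 0" for a b
  proof (cases "poly c b = 0")
    case False
    thus ?thesis
      using that by (simp add: eval_p)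
  next
    case True
    let ?l = "[:[:-b, 1:]:] :: bpoly"
    \<comment> \<open>The linear polynomial \<open>y - b\<close> is prime in R[y] and stays prime as
      a constant of R[y][x].\<close>
    have prime: "prime_elem ?l"
      by (intro lift_prime_elem_poly prime_elem_linear_poly) simp_all
    have "?l dvd p'"
      using True by (simp add: c poly_eq_0_iff_dvd)
    hence "\<not> ?l dvd g'"
      using cop prime by (meson coprime_def prime_elem_not_unit)
    moreover have "?l dvd h * g'"
      unfolding g[symmetric]
    proof (rule vanishes_on_line_imp_dvd)
      fix x
      have "eval_xy p x b = 0"
        using True by (simp add: eval_p)
      thus "eval_xy g x b = 0"
        by (simp add: same_zeros)
    qed
    ultimately have "?l dvd h"
      using prime by (simp add: prime_elem_dvd_mult_iff)
    \<comment> \<open>The factor \<open>?l\<close> evaluates to 0 at height \<open>b\<close>, hence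
      so does its multiple \<open>h\<close>.\<close>
    thus ?thesis
      by (auto elim!: dvdE simp: eval_xy_def)
  qed
  hence "zero_set h = zero_set p"
    by (auto simp: zero_set_def eval_p)
  thus ?thesis
    using assms(1) by (intro exI[of _ h]) (simp add: h_def)
qed

end
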